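(* Let $n\ge 2$ and let $\mathcal{Q}$ be any regular $n$-polytope circumscribed about a unit $n$-sphere. Let $F$ be the number of facets of $\mathcal{Q}$, let $N$ be the number of line segments whose endpoints are centers of two distinct facets of $\mathcal{Q}$, and let $s_1,\dots,s_N$ be the lengths of these line segments (one entry for each segment). Then $$\sum_{i=1}^{N}s_i^2=F^2 .$$
   Context: An $n$-polytope is a finite convex polytope of full dimension $n$ in Euclidean space $\mathbb{R}^n$; its $(n-1)$-faces are its facets. An $n$-polytope is regular (the usual notion of regular convex polytope) if (1) whenever a $(j-2)$-face is incident with a $j$-face, exactly two $(j-1)$-faces are incident with both ($1\le j\le n$, counting the empty set as the unique $(-1)$-face), and (2) there is a point $\mathbf{O}$, the center, such that for each $j\in\{0,\dots,n\}$ the centers of all $j$-faces are at the same distance from $\mathbf{O}$. A unit $n$-sphere is a sphere of radius $1$ in $\mathbb{R}^n$ (so a "2-sphere" is a circle). A regular polytope is circumscribed about it if all its facets are tangent to the sphere (the facets touch the sphere at their centers, and the sphere's center is the center of the polytope). *)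

theory Defs
  imports "HOL-Analysis.Analysis"
begin

definition dim_face_of :: "'a::euclidean_space set \<Rightarrow> int \<Rightarrow> 'a set \<Rightarrow> bool" where
  "dim_face_of f j P \<longleftrightarrow> f face_of P \<and> aff_dim f = j"

text \<open>The center of a face is the barycenter of its vertices; so a vertex is its own center
  and the center of an edge is its midpoint.\<close>

definition face_center :: "'a::euclidean_space set \<Rightarrow> 'a" where
  "face_center f = (\<Sum>v\<in>{v. v extreme_point_of f}. v) /\<^sub>R real (card {v. v extreme_point_of f})"

definition full_dim_polytope :: "'a::euclidean_space set \<Rightarrow> bool" where
  "full_dim_polytope P \<longleftrightarrow> polytope P \<and> aff_dim P = int DIM('a)"

text \<open>For \<open>j = 1\<close> the lower face is the empty set, whose affine dimension is \<open>-1\<close>;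
  for \<open>j = DIM('a)\<close> the upper face is \<open>P\<close> itself.\<close>

definition two_between_property :: "'a::euclidean_space set \<Rightarrow> bool" where
  "two_between_property P \<longleftrightarrow>
     (\<forall>j\<in>{1..int DIM('a)}. \<forall>f g. dim_face_of f (j - 2) P \<and> dim_face_of g j P \<and> f \<subseteq> g \<longrightarrow>
        card {h. dim_face_of h (j - 1) P \<and> f \<subseteq> h \<and> h \<subseteq> g} = 2)"

definition is_center :: "'a::euclidean_space set \<Rightarrow> 'a \<Rightarrow> bool" where
  "is_center P c \<longleftrightarrow>
     (\<forall>j\<in>{0..int DIM('a)}. \<exists>R. \<forall>f. dim_face_of f j P \<longrightarrow> dist c (face_center f) = R)"

definition regular_polytope :: "'a::euclidean_space set \<Rightarrow> bool" where
  "regular_polytope P \<longleftrightarrow>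
     full_dim_polytope P \<and> two_between_property P \<and> (\<exists>c. is_center P c)"

text \<open>A flat of dimension at least 1 is tangent to a sphere iff it meets it in exactly one point.
  The flat meant here is the one spanned by \<open>f\<close>, and the point of contact has to lie in \<open>f\<close>.\<close>

definition tangent_to_sphere_at :: "'a::euclidean_space set \<Rightarrow> 'a \<Rightarrow> real \<Rightarrow> 'a \<Rightarrow> bool" where
  "tangent_to_sphere_at f c r x \<longleftrightarrow> x \<in> f \<and> affine hull f \<inter> sphere c r = {x}"

definition circumscribed_about_sphere :: "'a::euclidean_space set \<Rightarrow> 'a \<Rightarrow> real \<Rightarrow> bool" where
  "circumscribed_about_sphere P c r \<longleftrightarrow>
     is_center P c \<and> (\<forall>f. f facet_of P \<longrightarrow> tangent_to_sphere_at f c r (face_center f))"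

definition facet_center_segments :: "'a::euclidean_space set \<Rightarrow> 'a set set" where
  "facet_center_segments P =
     {closed_segment (face_center f) (face_center g) | f g. f facet_of P \<and> g facet_of P \<and> f \<noteq> g}"

text \<open>The length of a segment, given as a point set, is its diameter.\<close>

lemma diameter_closed_segment: "diameter (closed_segment a b) = dist a b"
  for a b :: "'a::euclidean_space"
proof (rule antisym)
  have "norm (x - y) \<le> dist a b" if "x \<in> closed_segment a b" "y \<in> closed_segment a b" for x y
    using segment_furthest_le[OF that(2), of x] segment_bound[OF that(1)]
    by (auto simp: dist_norm norm_minus_commute)
  then show "diameter (closed_segment a b) \<le> dist a b"
    by (intro diameter_le) auto
  show "dist a b \<le> diameter (closed_segment a b)"
    by (rule diameter_bounded_bound) (auto simp: bounded_closed_segment)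
qed

end

theory Submission
  imports Defs
begin

text \<open>Put \<open>u f\<close> for the vector from the center to the center of the facet \<open>f\<close>. The \<open>u f\<close> are unit vectors, so the
sum of \<open>\<parallel>u f - u g\<parallel>\<^sup>2\<close> over ordered pairs of facets is \<open>2 F\<^sup>2 - 2 \<parallel>\<Sum>f. u f\<parallel>\<^sup>2\<close>, and every segment accounts for
two ordered pairs because distinct facets have distinct centers. Everything therefore rests on \<open>\<Sum>f. u f = 0\<close>,
and this is where regularity enters: the polytope has so many symmetries that they fix no point except
the center.

Regularity is given metrically, as equal distances from a point to the centers of all faces of one
dimension, and the symmetries have to be produced from that. The property is hereditary: by Pythagoras a face has it
with respect to the foot of the perpendicular from the center, with radii that depend only on the dimension
of the face once this foot is known to be the barycenter of its vertices. Induction on the dimension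
(\<open>face_centered_rigid\<close>) proves three things together.

\<^item> The center lies in the relative interior, and the hyperplane of each facet is perpendicular to the vector
  to its center (\<open>center_in_rel_interior\<close>, \<open>affine_hull_facet\<close>).

\<^item> Rigidity (\<open>eq_of_shared_facet\<close>): two such polytopes with the same radii, center and affine hull
  coincide as soon as they share a facet. If they share \<open>g\<close>, then on the other side of a ridge of \<open>g\<close> the two
  neighbouring facets have the same center, hence the same affine hull and radii, and both contain the ridge, so they
  coincide by induction. Equality spreads over all facets because the facets of a polytope are connected through
  ridges (\<open>polytope_facets_ridge_connected\<close>).

\<^item> Symmetry (\<open>reflection_symmetry\<close>): the reflection that exchanges the centers of two adjacent facets fixes
  their common ridge, so by rigidity it maps one of these facets to the other, and then the polytope to itself.

The vector from the center to a point fixed by all these reflections has the same inner product with all \<open>u f\<close>, again by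
connectedness. If it were not zero, the two opposite rays from the center along it would leave the polytope through facets for which
that inner product has opposite signs, so the point is the center
(\<open>fixed_by_facet_symmetries_imp_center\<close>). Applied to the barycenter of the vertices this closes the
induction, and applied to the sum of the \<open>u f\<close> it gives the vanishing sum (\<open>sum_facet_centers\<close>).\<close>

section \<open>Connectedness of the facets of a polytope through ridges\<close>

lemma affine_contains_line:
  fixes L :: "'a::real_vector set"
  assumes "affine L" "x \<in> L" "y \<in> L" "x = p + s *\<^sub>R (q - p)" "y = p + t *\<^sub>R (q - p)" "s \<noteq> t"
  shows "p + w *\<^sub>R (q - p) \<in> L"
proof -
  have "x + ((w - s) / (t - s)) *\<^sub>R (y - x) \<in> L"
  proof -
    have "(1 - (w - s) / (t - s)) *\<^sub>R x + ((w - s) / (t - s)) *\<^sub>R y \<in> L"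
      using assms by (intro mem_affine) auto
    then show ?thesis by (simp add: algebra_simps)
  qed
  also have "y - x = (t - s) *\<^sub>R (q - p)" unfolding assms(4,5) by (simp add: algebra_simps)
  also have "x + ((w - s) / (t - s)) *\<^sub>R ((t - s) *\<^sub>R (q - p)) = x + (w - s) *\<^sub>R (q - p)"
    using assms(6) by simp
  also have "\<dots> = p + w *\<^sub>R (q - p)" unfolding assms(4) by (simp add: algebra_simps)
  finally show ?thesis .
qed

text \<open>If no set of the family contains \<open>S\<close>, take a point of \<open>S\<close> outside the last set and, by induction, one outside
the union of the others. No set of the family contains the whole line through them, so each set meets it in at most one point, and finitely many
points cannot exhaust a segment. The lemma provides points in general position.\<close>

lemma convex_subset_Union_affine:
  fixes S :: "'a::real_vector set"
  assumes "finite \<L>" "\<And>L. L \<in> \<L> \<Longrightarrow> affine L" "convex S" "S \<noteq> {}" "S \<subseteq> \<Union>\<L>"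
  shows "\<exists>L\<in>\<L>. S \<subseteq> L"
  using assms
proof (induction \<L> rule: finite_induct)
  case empty
  then show ?case by simp
next
  case (insert M \<L>)
  show ?case
  proof (rule ccontr)
    assume neg: "\<not> (\<exists>L\<in>insert M \<L>. S \<subseteq> L)"
    then have "\<not> S \<subseteq> \<Union>\<L>"
      using insert by auto
    then obtain q where q: "q \<in> S" "q \<notin> \<Union>\<L>" by blast
    obtain p where p: "p \<in> S" "p \<notin> M" using neg by blast
    define \<gamma> where "\<gamma> t = p + t *\<^sub>R (q - p)" for t
    have gS: "\<gamma> t \<in> S" if "t \<in> {0..1}" for t
    proof -
      have "(1 - t) *\<^sub>R p + t *\<^sub>R q \<in> S"
        using that p q insert.prems(2) by (intro convexD) auto
      then show ?thesis by (simp add: \<gamma>_def algebra_simps)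
    qed
    have one: "s = t" if "L \<in> insert M \<L>" "\<gamma> s \<in> L" "\<gamma> t \<in> L" for L s t
    proof (rule ccontr)
      assume "s \<noteq> t"
      then have all: "\<gamma> w \<in> L" for w
        unfolding \<gamma>_def
        using affine_contains_line[of L "\<gamma> s" "\<gamma> t" p s q t w] that insert.prems(1) \<gamma>_def by blast
      have "p \<in> L" "q \<in> L" using all[of 0] all[of 1] by (auto simp: \<gamma>_def)
      then show False using p q that(1) by auto
    qed
    have "finite {t. \<gamma> t \<in> L}" if "L \<in> insert M \<L>" for L
    proof (cases "{t. \<gamma> t \<in> L} = {}")
      case False
      then obtain s where "\<gamma> s \<in> L" by auto
      then have "{t. \<gamma> t \<in> L} \<subseteq> {s}" using one that by blast
      then show ?thesis by (rule finite_subset) simp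
    qed simp
    then have "finite (\<Union>L\<in>insert M \<L>. {t. \<gamma> t \<in> L})"
      using insert.hyps by blast
    moreover have "{0..1::real} \<subseteq> (\<Union>L\<in>insert M \<L>. {t. \<gamma> t \<in> L})"
      using gS insert.prems(4) by blast
    ultimately have "finite {0..1::real}" by (rule rev_finite_subset)
    then show False using infinite_Icc[of 0 "1::real"] by simp
  qed
qed

lemma rel_frontier_segment_unique:
  fixes S :: "'a::euclidean_space set"
  assumes "convex S" "closed S" "z \<in> rel_interior S" "w \<in> rel_frontier S" "w' \<in> rel_frontier S"
    "t \<in> closed_segment z w" "t \<in> closed_segment z w'" "t \<noteq> z"
  shows "w = w'"
proof -
  obtain a where a: "0 \<le> a" "a \<le> 1" "t = (1 - a) *\<^sub>R z + a *\<^sub>R w"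
    using assms(6) by (auto simp: in_segment)
  obtain b where b: "0 \<le> b" "b \<le> 1" "t = (1 - b) *\<^sub>R z + b *\<^sub>R w'"
    using assms(7) by (auto simp: in_segment)
  have ab: "a > 0" "b > 0" using a b assms(8) by (auto simp: less_le)
  have eq: "a *\<^sub>R (w - z) = b *\<^sub>R (w' - z)"
    using a(3) b(3) by (simp add: algebra_simps)
  have not_inner: "\<not> u < 1" if "0 < u" "x \<in> rel_frontier S" "y \<in> rel_frontier S"
      "x - z = u *\<^sub>R (y - z)" for x y and u :: real
  proof
    assume "u < 1"
    have yz: "y \<noteq> z" using that assms(3) by (auto simp: rel_frontier_def)
    have "x = (1 - u) *\<^sub>R z + u *\<^sub>R y" using that(4) by (simp add: algebra_simps)
    then have "x \<in> open_segment z y" using that(1) \<open>u < 1\<close> yz by (auto simp: in_segment)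
    moreover have "y \<in> closure S" using that(3) by (auto simp: rel_frontier_def)
    ultimately have "x \<in> rel_interior S"
      using rel_interior_closure_convex_segment[OF assms(1,3)] by blast
    then show False using that(2) by (auto simp: rel_frontier_def)
  qed
  have "w - z = (b / a) *\<^sub>R (w' - z)" 
    using arg_cong[OF eq, of "\<lambda>v. (1/a) *\<^sub>R v"] ab by simp
  moreover have "w' - z = (a / b) *\<^sub>R (w - z)"
    using arg_cong[OF eq, of "\<lambda>v. (1/b) *\<^sub>R v"] ab by simp
  ultimately have "\<not> b / a < 1" "\<not> a / b < 1"
    using not_inner[of "b / a" w w'] not_inner[of "a / b" w' w] ab assms by auto
  then have "a = b" using ab by (simp add: field_simps)
  then show ?thesis using eq ab by simp
qed

lemma ray_meets_facet:
  fixes P :: "'a::euclidean_space set"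
  assumes "polytope P" "z \<in> rel_interior P" "z + v \<in> affine hull P" "v \<noteq> 0"
  obtains t F where "0 < t" "F facet_of P" "z + t *\<^sub>R v \<in> F"
proof -
  obtain t where "0 < t" "z + t *\<^sub>R v \<in> rel_frontier P"
    using ray_to_rel_frontier[of P z v] assms polytope_imp_bounded by metis
  then show ?thesis
    using rel_frontier_of_polyhedron[OF polytope_imp_polyhedron[OF assms(1)]] that by auto
qed

lemma mem_segment_to_facet:
  fixes P :: "'a::euclidean_space set"
  assumes "polytope P" "z \<in> rel_interior P" "t \<in> P" "t \<noteq> z"
  obtains w F where "F facet_of P" "w \<in> F" "t \<in> closed_segment z w"
proof -
  have "z + (t - z) \<in> affine hull P" using assms(3) by (simp add: hull_inc)
  then obtain s F where s: "0 < s" "F facet_of P" "z + s *\<^sub>R (t - z) \<in> F"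
    using ray_meets_facet[of P z "t - z"] assms by auto
  define w where "w = z + s *\<^sub>R (t - z)"
  have wfr: "w \<in> rel_frontier P"
    using s rel_frontier_of_polyhedron[OF polytope_imp_polyhedron[OF assms(1)]] w_def by auto
  have "s \<ge> 1"
  proof (rule ccontr)
    assume "\<not> 1 \<le> s"
    then have "w \<in> open_segment z t"
      using s assms(4) by (auto simp: in_segment w_def algebra_simps intro!: exI[of _ s])
    then have "w \<in> rel_interior P"
      using rel_interior_closure_convex_segment[of P z t] assms closure_subset
        polytope_imp_convex by blast
    then show False using wfr by (auto simp: rel_frontier_def)
  qed
  then have "t \<in> closed_segment z w"
    unfolding in_segment using s(1)
    by (intro exI[of _ "1/s"]) (auto simp: w_def algebra_simps)
  then show ?thesis using that s w_def by blast
qed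

text \<open>Walking along a generic segment inside \<open>P\<close> and projecting from an interior point \<open>z\<close> to the boundary,
one passes from facet to facet. Facets with and without \<open>\<Phi>\<close> must touch somewhere on the way, and a generic segment avoids
the finitely many cones over faces of codimension three or more, so they touch in a ridge.\<close>

lemma polytope_facets_ridge_connected:
  fixes P :: "'a::euclidean_space set"
  assumes P: "polytope P" "aff_dim P \<ge> 1"
    and g0: "g0 facet_of P" "\<Phi> g0" and h0: "h0 facet_of P" "\<not> \<Phi> h0"
  obtains g h where "g facet_of P" "h facet_of P" "\<Phi> g" "\<not> \<Phi> h" 
    "aff_dim (g \<inter> h) = aff_dim P - 2"
proof -
  have conv: "convex P" and clo: "closed P"
    using P by (auto simp: polytope_imp_convex polytope_imp_closed)
  have fr: "F \<subseteq> rel_frontier P" if "F facet_of P" for F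
    using rel_frontier_of_polyhedron[OF polytope_imp_polyhedron[OF P(1)]] that by auto
  have dlt: "aff_dim (g \<inter> h) \<le> aff_dim P - 2"
    if "g facet_of P" "h facet_of P" "g \<noteq> h" for g h
  proof -
    have gh: "g \<inter> h face_of P" "convex g" "convex h" "aff_dim g = aff_dim P - 1"
       "aff_dim h = aff_dim P - 1"
      using that by (auto simp: facet_of_def face_of_Int face_of_imp_convex)
    have "g \<inter> h face_of g" "g \<inter> h face_of h"
      using gh that by (auto intro: face_of_subset dest: facet_of_imp_subset)
    moreover have "g \<inter> h \<noteq> g \<or> g \<inter> h \<noteq> h" using that by auto
    ultimately have "aff_dim (g \<inter> h) < aff_dim P - 1"
      using face_of_aff_dim_lt gh by metis
    then show ?thesis by simp
  qed
  have "P \<noteq> {}" using g0 by auto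
  then obtain z where z: "z \<in> rel_interior P" using conv rel_interior_eq_empty by auto
  obtain x where x: "x \<in> rel_interior g0"
    using g0 rel_interior_eq_empty[of g0] face_of_imp_convex[of g0 P] by (auto simp: facet_of_def)
  have xg0: "x \<in> g0" using x rel_interior_subset by auto
  have xfr: "x \<in> rel_frontier P" using xg0 fr g0 by auto
  have xz: "x \<noteq> z" using z xfr by (auto simp: rel_frontier_def)
  define \<E> where "\<E> = {E. E face_of P \<and> aff_dim E \<le> aff_dim P - 3}"
  have finE: "finite \<E>"
    using finite_polytope_faces[OF P(1)] by (rule rev_finite_subset) (auto simp: \<E>_def)
  have "\<not> h0 \<subseteq> affine hull (insert z (insert x E))" if E: "E \<in> \<E>" for E
  proof
    assume sub: "h0 \<subseteq> affine hull (insert z (insert x E))"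
    have "z \<notin> affine hull h0"
      using affine_hull_face_of_disjoint_rel_interior[OF conv, of h0] h0 z
        facet_of_irrefl[of P] by (auto simp del: facet_of_irrefl simp: facet_of_imp_face_of)
    then have "aff_dim (insert z h0) = aff_dim P"
      using h0 by (simp add: aff_dim_insert facet_of_def)
    moreover have "aff_dim (insert z h0) \<le> aff_dim (affine hull (insert z (insert x E)))"
      using sub by (intro aff_dim_subset) (simp add: hull_inc)
    moreover have "aff_dim (insert z (insert x E)) \<le> aff_dim E + 2"
      by (simp add: aff_dim_insert)
    ultimately show False using E by (simp add: \<E>_def)
  qed
  moreover have "affine L" if "L \<in> (\<lambda>E. affine hull (insert z (insert x E))) ` \<E>" for L
    using that by auto
  moreover have "convex h0" "h0 \<noteq> {}" using h0 by (auto simp: facet_of_def face_of_imp_convex)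
  ultimately have "\<not> h0 \<subseteq> \<Union>((\<lambda>E. affine hull (insert z (insert x E))) ` \<E>)"
    using convex_subset_Union_affine[of "(\<lambda>E. affine hull (insert z (insert x E))) ` \<E>" h0]
      finE by blast
  \<comment> \<open>\<open>y\<close> is generic: each affine hull of \<open>z\<close>, \<open>x\<close> and a low-dimensional face cuts \<open>h0\<close> in a proper subset.\<close>
  then obtain y where y: "y \<in> h0" "\<And>E. E \<in> \<E> \<Longrightarrow> y \<notin> affine hull (insert z (insert x E))"
    by blast
  have xP: "x \<in> P" "y \<in> P" "z \<in> P" 
    using xg0 y g0 h0 z rel_interior_subset by (auto dest: facet_of_imp_subset)
  have yz: "y \<noteq> z" using fr[OF h0(1)] y z by (auto simp: rel_frontier_def)
  have line: "y \<in> affine hull (insert z (insert x E))"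
    if t: "t \<in> closed_segment x y" "t \<noteq> x" "t \<in> affine hull (insert z (insert x E))" for t E
  proof -
    obtain u where u: "0 \<le> u" "u \<le> 1" "t = (1 - u) *\<^sub>R x + u *\<^sub>R y"
      using t(1) by (auto simp: in_segment)
    have u0: "u \<noteq> 0"
    proof
      assume "u = 0"
      with u(3) have "t = x" by simp
      with t(2) show False by contradiction
    qed
    let ?A = "affine hull (insert z (insert x E))"
    have xin: "x \<in> ?A" by (rule hull_inc) simp
    have x0: "x = x + 0 *\<^sub>R (y - x)" by simp
    have tu: "t = x + u *\<^sub>R (y - x)" using u(3) by (simp add: algebra_simps)
    have "0 \<noteq> u" using u0 by simp
    from affine_contains_line[OF affine_affine_hull xin t(3) x0 tu this, of 1]
    have "x + 1 *\<^sub>R (y - x) \<in> ?A" .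
    then show ?thesis by simp
  qed
  define K where "K F = convex hull (insert z F)" for F
  have Kcomp: "closed (K F)" if "F facet_of P" for F
    unfolding K_def
    using that P face_of_polytope_polytope[of P F] polytope_imp_compact
    by (intro compact_imp_closed compact_convex_hull compact_insert) (auto simp: facet_of_def)
  have Kmem: "\<exists>w\<in>F. t \<in> closed_segment z w" if "t \<in> K F" "F facet_of P" for t F
  proof -
    have "F \<noteq> {}" "convex F" using that by (auto simp: facet_of_def face_of_imp_convex)
    then show ?thesis using that(1) by (auto simp: K_def convex_hull_insert_segments hull_same)
  qed
  have Kseg: "t \<in> K F" if "w \<in> F" "t \<in> closed_segment z w" for t w F
    using that unfolding K_def
    by (meson closed_segment_subset convex_convex_hull hull_inc insertI1 insertI2 subsetD)
  define A where "A = \<Union>(K ` {F. F facet_of P \<and> \<Phi> F})"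
  define B where "B = \<Union>(K ` {F. F facet_of P \<and> \<not> \<Phi> F})"
  have finF: "finite {F. F facet_of P}"
    using finite_polytope_facets[OF P(1)] .
  have "closed A" "closed B"
    unfolding A_def B_def using finF Kcomp by (auto intro!: closed_UN)
  have xA: "x \<in> A" using Kseg[of x g0 x] xg0 g0 by (auto simp: A_def)
  have yB: "y \<in> B" using Kseg[of y h0 y] y h0 by (auto simp: B_def)
  have "P \<subseteq> A \<union> B"
  proof
    fix t assume t: "t \<in> P"
    show "t \<in> A \<union> B"
    proof (cases "t = z")
      case True
      then have "t \<in> K g0" by (simp add: K_def hull_inc)
      then show ?thesis using g0 by (auto simp: A_def)
    next
      case False
      then obtain w F where F: "F facet_of P" and wF: "w \<in> F" "t \<in> closed_segment z w"
        using mem_segment_to_facet[OF P(1) z t] by blast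
      have "t \<in> K F" using Kseg[OF wF] .
      then show ?thesis using F by (cases "\<Phi> F") (auto simp: A_def B_def)
    qed
  qed
  then have "closed_segment x y \<subseteq> A \<union> B"
    using closed_segment_subset[OF xP(1,2) conv] by blast
  \<comment> \<open>The segment is connected, and the closed sets \<open>A\<close> and \<open>B\<close> cover it and both meet it.\<close>
  then have "A \<inter> B \<inter> closed_segment x y \<noteq> {}"
    using connected_closedD[of "closed_segment x y" A B] \<open>closed A\<close> \<open>closed B\<close> xA yB by auto
  then obtain t g h where t: "t \<in> closed_segment x y" "g facet_of P" "\<Phi> g" "t \<in> K g"
      "h facet_of P" "\<not> \<Phi> h" "t \<in> K h"
    by (auto simp: A_def B_def)
  have gh: "g \<noteq> h" using t by auto
  have "aff_dim (g \<inter> h) \<ge> aff_dim P - 2"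
  proof (rule ccontr)
    assume neg: "\<not> aff_dim (g \<inter> h) \<ge> aff_dim P - 2"
    have E: "g \<inter> h \<in> \<E>" 
      using neg t by (auto simp: \<E>_def facet_of_def face_of_Int)
    \<comment> \<open>The affine hull of \<open>z\<close>, \<open>x\<close> and \<open>g \<inter> h\<close> contains the line through \<open>x\<close> and \<open>z\<close>, and \<open>y\<close> is outside it.\<close>
    have tz: "t \<noteq> z"
      using line[of t "g \<inter> h"] y(2)[OF E] t xz by (auto simp: hull_inc)
    obtain w where w: "w \<in> g" "t \<in> closed_segment z w" using Kmem t by blast
    obtain w' where w': "w' \<in> h" "t \<in> closed_segment z w'" using Kmem t by blast
    have ww': "w = w'"
      using rel_frontier_segment_unique[OF conv clo z _ _ w(2) w'(2) tz] fr t w w' by blast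
    have "t \<in> affine hull (insert z (insert x (g \<inter> h)))"
    proof -
      have "closed_segment z w \<subseteq> affine hull (insert z (insert x (g \<inter> h)))"
        using w w' ww' by (intro closed_segment_subset affine_imp_convex) (auto simp: hull_inc)
      then show ?thesis using w by blast
    qed
    then have tx: "t = x" using line[of t "g \<inter> h"] y(2)[OF E] t by blast
    \<comment> \<open>If the pyramids \<open>K g\<close> and \<open>K h\<close> meet at the start \<open>x\<close>, then both facets contain \<open>x\<close>; as \<open>x\<close> is a relative interior point of
\<open>g0\<close>, both contain \<open>g0\<close>, which is too large for the intersection of two facets.\<close>
    have "w = x"
      using rel_frontier_segment_unique[OF conv clo z _ xfr w(2) _ tz] fr t w tx by auto
    then have "x \<in> g" "x \<in> h" using w w' ww' by auto
    then have "g0 \<subseteq> g" "g0 \<subseteq> h"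
      using subset_of_face_of[of g P g0] subset_of_face_of[of h P g0] t g0 x
      by (auto simp: facet_of_def dest: face_of_imp_subset)
    then have "aff_dim g0 \<le> aff_dim (g \<inter> h)" by (simp add: aff_dim_subset)
    then show False using dlt[OF t(2,5) gh] g0 by (simp add: facet_of_def)
  qed
  then have "aff_dim (g \<inter> h) = aff_dim P - 2" using dlt[OF t(2,5) gh] by simp
  then show ?thesis using that t by blast
qed

section \<open>Face centers, isometries and faces\<close>

lemma face_center_mem:
  assumes "polytope f" "f \<noteq> {}"
  shows "face_center f \<in> f"
proof -
  let ?V = "{v. v extreme_point_of f}"
  have fin: "finite ?V"
    using assms polytope_imp_polyhedron finite_polyhedron_extreme_points by blast
  have "?V \<noteq> {}"
    using assms extreme_point_exists_convex polytope_imp_compact polytope_imp_convex by blast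
  then have card: "real (card ?V) \<noteq> 0" using fin by simp
  have "(\<Sum>v\<in>?V. (1 / real (card ?V)) *\<^sub>R v) \<in> f"
    using assms fin card
    by (intro convex_sum) (auto simp: polytope_imp_convex extreme_point_of_def)
  then show ?thesis by (simp add: face_center_def scaleR_sum_right divide_inverse)
qed

lemma face_center_affine_image:
  fixes L :: "'a::euclidean_space \<Rightarrow> 'a"
  assumes "polytope f" "f \<noteq> {}" "linear L" "inj L"
  shows "face_center ((\<lambda>x. b + L x) ` f) = b + L (face_center f)"
proof -
  let ?T = "\<lambda>x. b + L x"
  let ?V = "{v. v extreme_point_of f}"
  have inj: "inj ?T" using assms(4) by (auto simp: inj_def)
  have fin: "finite ?V"
    using assms polytope_imp_polyhedron finite_polyhedron_extreme_points by blast
  have "?V \<noteq> {}"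
    using assms extreme_point_exists_convex polytope_imp_compact polytope_imp_convex by blast
  then have card: "real (card ?V) \<noteq> 0" using fin by simp
  have im: "?T ` S = (+) b ` L ` S" for S by auto
  have "v extreme_point_of f \<longleftrightarrow> ?T v extreme_point_of (?T ` f)" for v
  proof -
    have "?T v extreme_point_of (?T ` f) \<longleftrightarrow> L v extreme_point_of (L ` f)"
      by (simp add: im extreme_point_of_translation_eq)
    also have "\<dots> \<longleftrightarrow> v extreme_point_of f"
      using face_of_linear_image[OF assms(3,4), of "{v}" f] by (simp add: face_of_singleton)
    finally show ?thesis by simp
  qed
  moreover have "y \<in> range ?T" if "y extreme_point_of (?T ` f)" for y
    using that by (auto simp: extreme_point_of_def)
  ultimately have ext: "{v. v extreme_point_of (?T ` f)} = ?T ` ?V"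
    by auto
  have "face_center (?T ` f) = (\<Sum>v\<in>?V. ?T v) /\<^sub>R real (card ?V)"
    unfolding face_center_def ext
    using inj by (simp add: sum.reindex card_image inj_on_subset[OF inj])
  also have "(\<Sum>v\<in>?V. ?T v) = real (card ?V) *\<^sub>R b + L (\<Sum>v\<in>?V. v)"
    by (simp add: sum.distrib linear_sum[OF assms(3)] sum_constant_scaleR)
  also have "\<dots> /\<^sub>R real (card ?V) = b + L ((\<Sum>v\<in>?V. v) /\<^sub>R real (card ?V))"
    using card by (simp add: scaleR_add_right linear_cmul[OF assms(3)])
  finally show ?thesis by (simp add: face_center_def)
qed

lemma face_of_affine_image:
  fixes L :: "'a::euclidean_space \<Rightarrow> 'a"
  assumes "linear L" "inj L"
  shows "(\<lambda>x. b + L x) ` f face_of (\<lambda>x. b + L x) ` P \<longleftrightarrow> f face_of P"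
proof -
  have "(\<lambda>x. b + L x) ` S = (+) b ` L ` S" for S by auto
  then show ?thesis using face_of_linear_image[OF assms] by simp
qed

lemma face_of_affine_imageE:
  fixes L :: "'a::euclidean_space \<Rightarrow> 'a"
  assumes "linear L" "inj L" "g face_of (\<lambda>x. b + L x) ` P"
  obtains f where "f face_of P" "g = (\<lambda>x. b + L x) ` f"
proof -
  obtain f where "g = (\<lambda>x. b + L x) ` f"
    using assms(3) by (meson face_of_imp_subset subset_imageE)
  then show ?thesis using that assms face_of_affine_image[OF assms(1,2)] by blast
qed

lemma affine_hull_affine_image:
  fixes L :: "'a::euclidean_space \<Rightarrow> 'a"
  assumes "linear L"
  shows "affine hull ((\<lambda>x. b + L x) ` S) = (\<lambda>x. b + L x) ` (affine hull S)"
proof -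
  have im: "(\<lambda>x. b + L x) ` S = (+) b ` L ` S" for S by auto
  show ?thesis
    using affine_hull_linear_image[of L S] assms
    by (simp add: im affine_hull_translation linear_conv_bounded_linear)
qed

lemma aff_dim_affine_image:
  fixes L :: "'a::euclidean_space \<Rightarrow> 'a"
  assumes "linear L" "inj L"
  shows "aff_dim ((\<lambda>x. b + L x) ` S) = aff_dim S"
proof -
  have im: "(\<lambda>x. b + L x) ` S = (+) b ` L ` S" for S by auto
  show ?thesis using assms by (simp add: im aff_dim_translation_eq)
qed

text \<open>The metric part of regularity, for polytopes of any dimension inside the ambient space. Requiring \<open>c\<close> in
the affine hull lets proper faces be treated on the same footing as the whole polytope.\<close>

definition face_centered :: "(nat \<Rightarrow> real) \<Rightarrow> 'a \<Rightarrow> 'a::euclidean_space set \<Rightarrow> bool" where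
  "face_centered R c P \<longleftrightarrow> polytope P \<and> c \<in> affine hull P \<and>
     (\<forall>f j. f face_of P \<and> aff_dim f = int j \<longrightarrow> dist c (face_center f) = R j)"

lemma face_centered_isometric_image:
  fixes L :: "'a::euclidean_space \<Rightarrow> 'a"
  assumes "face_centered R c P" "orthogonal_transformation L"
  shows "face_centered R (b + L c) ((\<lambda>x. b + L x) ` P)"
proof -
  have L: "linear L" "inj L"
    using assms(2) orthogonal_transformation_linear orthogonal_transformation_inj by auto
  have im: "(\<lambda>x. b + L x) ` S = (+) b ` L ` S" for S by auto
  have "polytope ((\<lambda>x. b + L x) ` P)"
    using assms(1) L by (simp add: im polytope_translation_eq polytope_linear_image face_centered_def)
  moreover have "b + L c \<in> affine hull ((\<lambda>x. b + L x) ` P)"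
    using assms(1) by (simp add: affine_hull_affine_image[OF L(1)] face_centered_def)
  moreover have "dist (b + L c) (face_center g) = R j"
    if g: "g face_of (\<lambda>x. b + L x) ` P" and dim: "aff_dim g = int j" for g j
  proof -
    obtain f where f: "f face_of P" "g = (\<lambda>x. b + L x) ` f"
      using face_of_affine_imageE[OF L g] by blast
    have fdim: "aff_dim f = int j" using dim f aff_dim_affine_image[OF L] by simp
    have "polytope f" "f \<noteq> {}"
      using f fdim assms(1) face_of_polytope_polytope by (auto simp: face_centered_def)
    then have "face_center g = b + L (face_center f)"
      using face_center_affine_image L f by blast
    moreover have "dist (L c) (L (face_center f)) = dist c (face_center f)"
      using assms(2) by (metis L(1) dist_norm linear_diff orthogonal_transformation_norm)
    ultimately show ?thesis
      using assms(1) f fdim by (simp add: face_centered_def)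
  qed
  ultimately show ?thesis by (simp add: face_centered_def)
qed

text \<open>By Pythagoras, distances from \<open>p\<close> to points of the face are determined by distances from \<open>c\<close>, since
\<open>c - p\<close> is perpendicular to the face.\<close>

lemma face_centered_face:
  assumes "face_centered R c P" "f face_of P" "p \<in> affine hull f"
    and orth: "\<And>x. x \<in> affine hull f \<Longrightarrow> (c - p) \<bullet> (x - p) = 0"
  shows "face_centered (\<lambda>j. sqrt ((R j)\<^sup>2 - (dist c p)\<^sup>2)) p f"
proof -
  have pf: "polytope f"
    using assms face_of_polytope_polytope by (auto simp: face_centered_def)
  have "dist p (face_center g) = sqrt ((R j)\<^sup>2 - (dist c p)\<^sup>2)"
    if g: "g face_of f" "aff_dim g = int j" for g j
  proof -
    have "polytope g" "g \<noteq> {}" using g pf face_of_polytope_polytope by auto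
    then have "face_center g \<in> g" by (rule face_center_mem)
    then have m: "face_center g \<in> affine hull f"
      using face_of_imp_subset[OF g(1)] by (intro hull_inc) auto
    have R: "dist c (face_center g) = R j"
      using assms(1,2) g face_of_trans unfolding face_centered_def by blast
    have "(dist c (face_center g))\<^sup>2 = (norm ((c - p) - (face_center g - p)))\<^sup>2"
      by (simp add: dist_norm)
    also have "\<dots> = (dist c p)\<^sup>2 + (dist p (face_center g))\<^sup>2"
      using orth[OF m] 
      by (simp add: dist_norm norm_minus_commute power2_norm_eq_inner inner_diff inner_commute algebra_simps)
    finally show ?thesis using R by simp
  qed
  then show ?thesis using assms(3) pf by (simp add: face_centered_def)
qed

lemma affine_hull_projection_exists:
  fixes S :: "'a::euclidean_space set"
  assumes "S \<noteq> {}"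
  obtains p where "p \<in> affine hull S" "\<And>x. x \<in> affine hull S \<Longrightarrow> (c - p) \<bullet> (x - p) = 0"
proof -
  let ?A = "affine hull S"
  have A: "convex ?A" "closed ?A" "?A \<noteq> {}"
    using assms by (auto simp: affine_imp_convex)
  define p where "p = closest_point ?A c"
  have p: "p \<in> ?A" "\<forall>z\<in>?A. dist c p \<le> dist c z"
    using closest_point_exists[OF A(2,3), of c] by (auto simp: p_def)
  have "(c - p) \<bullet> (x - p) = 0" if x: "x \<in> ?A" for x
  proof -
    have "2 *\<^sub>R p + (-1) *\<^sub>R x \<in> ?A" using x p by (intro mem_affine) auto
    then have "(c - p) \<bullet> ((2 *\<^sub>R p + (-1) *\<^sub>R x) - p) \<le> 0"
      using any_closest_point_dot[OF A(1,2) p(1) _ p(2)] by blast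
    moreover have "(2 *\<^sub>R p + (-1) *\<^sub>R x) - p = - (x - p)" by (simp add: scaleR_2)
    ultimately have "0 \<le> (c - p) \<bullet> (x - p)" by (simp only: inner_minus_right)
    moreover have "(c - p) \<bullet> (x - p) \<le> 0"
      using any_closest_point_dot[OF A(1,2) p(1) x p(2)] .
    ultimately show ?thesis by simp
  qed
  then show ?thesis using that p by blast
qed

lemma proper_face_misses_extreme_point:
  fixes P :: "'a::euclidean_space set"
  assumes "polytope P" "g face_of P" "g \<noteq> P"
  obtains v where "v extreme_point_of P" "v \<notin> g"
proof -
  have "\<not> {v. v extreme_point_of P} \<subseteq> g"
  proof
    assume "{v. v extreme_point_of P} \<subseteq> g"
    then have "convex hull {v. v extreme_point_of P} \<subseteq> g"
      using assms by (simp add: face_of_imp_convex subset_hull)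
    then have "P \<subseteq> g"
      using Krein_Milman_Minkowski[of P] assms polytope_imp_compact polytope_imp_convex by auto
    then show False using assms face_of_imp_subset by blast
  qed
  then show ?thesis using that by blast
qed

text \<open>A vertex that is not the whole polytope lies in a facet; descend from facet to facet until the dimension is reached.\<close>

lemma face_of_each_dimension_at_vertex:
  fixes P :: "'a::euclidean_space set"
  assumes "polytope P" "v extreme_point_of P" "int k \<le> aff_dim P"
  obtains f where "f face_of P" "v \<in> f" "aff_dim f = int k"
proof -
  have "\<exists>f. f face_of P \<and> v \<in> f \<and> aff_dim f = int k"
    using assms
  proof (induction "nat (aff_dim P - int k)" arbitrary: P)
    case 0
    then show ?case
      by (intro exI[of _ P]) (auto simp: face_of_refl polytope_imp_convex extreme_point_of_def)
  next
    case (Suc m)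
    have "{v} face_of P" "{v} \<noteq> P"
      using Suc by (auto simp: face_of_singleton)
    then obtain F where F: "F facet_of P" "v \<in> F"
      using face_of_polyhedron_subset_facet[of P "{v}"] Suc polytope_imp_polyhedron by auto
    have "m = nat (aff_dim F - int k)" "polytope F" "v extreme_point_of F" "int k \<le> aff_dim F"
      using Suc F face_of_polytope_polytope[of P F] extreme_point_of_face[of F P v] 
      by (auto simp: facet_of_def)
    then show ?case
      using Suc.hyps(1)[of F] F by (meson face_of_trans facet_of_imp_face_of)
  qed
  then show ?thesis using that by blast
qed

text \<open>A point that is not in the relative interior lies in a facet, so the descent ends at a suitable face.\<close>

lemma mem_rel_interior_of_face:
  fixes P :: "'a::euclidean_space set"
  assumes "polytope P" "p \<in> P"
  obtains g where "g face_of P" "p \<in> rel_interior g"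
proof -
  have "\<exists>g. g face_of P \<and> p \<in> rel_interior g"
    using assms
  proof (induction "nat (aff_dim P)" arbitrary: P rule: less_induct)
    case less
    show ?case
    proof (cases "p \<in> rel_interior P")
      case True
      then show ?thesis using less face_of_refl polytope_imp_convex by blast
    next
      case False
      then have "p \<in> rel_frontier P"
        using less closure_subset by (auto simp: rel_frontier_def)
      then obtain F where F: "F facet_of P" "p \<in> F"
        using rel_frontier_of_polyhedron[of P] less polytope_imp_polyhedron by blast
      then have "polytope F" "nat (aff_dim F) < nat (aff_dim P)"
        using less face_of_polytope_polytope[of P F] aff_dim_geq[of F]
          aff_dim_empty[of F]
        unfolding facet_of_def by linarith+
      then show ?thesis
        using less.hyps[of F] F by (meson face_of_trans facet_of_imp_face_of)
    qed
  qed
  then show ?thesis using that by blast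
qed

section \<open>The center and the facets\<close>

text \<open>The setting of the induction step: for polytopes of smaller dimension the center is already known
to be the barycenter of the vertices.\<close>

locale face_centered_polytope =
  fixes R :: "nat \<Rightarrow> real" and c :: "'a::euclidean_space" and P :: "'a set"
  assumes fc: "face_centered R c P"
    and lower: "\<And>R' c' (Q :: 'a set). \<lbrakk>face_centered R' c' Q; aff_dim Q < aff_dim P\<rbrakk>
                  \<Longrightarrow> face_center Q = c'"
begin

text \<open>The common distance from the center to the centers of the facets; the conversion to a natural number is harmless because
a polytope with facets has positive dimension.\<close>

definition inradius :: real where
  "inradius = R (nat (aff_dim P - 1))"

lemma polytope: "polytope P" and center_in_hull: "c \<in> affine hull P"
  using fc by (auto simp: face_centered_def)

lemma convex: "convex P" and closed: "closed P"
  using polytope polytope_imp_convex polytope_imp_closed by auto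

lemma dist_face_center: "\<lbrakk>f face_of P; aff_dim f = int j\<rbrakk> \<Longrightarrow> dist c (face_center f) = R j"
  using fc by (auto simp: face_centered_def)

lemma face_center_in_face: "\<lbrakk>f face_of P; f \<noteq> {}\<rbrakk> \<Longrightarrow> face_center f \<in> f"
  using face_center_mem face_of_polytope_polytope polytope by blast

text \<open>The foot of the perpendicular to a proper face is a center of that face, so by induction it is the barycenter.\<close>

lemma face_center_eq_projection:
  assumes f: "f face_of P" "f \<noteq> P" and p: "p \<in> affine hull f"
    and orth: "\<And>x. x \<in> affine hull f \<Longrightarrow> (c - p) \<bullet> (x - p) = 0"
  shows "face_center f = p"
  using lower[OF face_centered_face[OF fc f(1) p orth]] face_of_aff_dim_lt[OF convex f] by blast

lemma face_center_orthogonal: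
  assumes f: "f face_of P" "f \<noteq> P" "f \<noteq> {}" and x: "x \<in> affine hull f"
  shows "(c - face_center f) \<bullet> (x - face_center f) = 0"
proof -
  obtain p where p: "p \<in> affine hull f" "\<And>x. x \<in> affine hull f \<Longrightarrow> (c - p) \<bullet> (x - p) = 0"
    using affine_hull_projection_exists[OF f(3)] by blast
  then have "face_center f = p" using face_center_eq_projection[OF f(1,2)] by blast
  then show ?thesis using p x by blast
qed

lemma proper_face_centered:
  assumes f: "f face_of P" "f \<noteq> P" "aff_dim f = int k"
  shows "face_centered (\<lambda>j. sqrt ((R j)\<^sup>2 - (R k)\<^sup>2)) (face_center f) f"
proof -
  have ne: "f \<noteq> {}" using f by auto
  then have m: "face_center f \<in> affine hull f"
    using face_center_in_face f by (simp add: hull_inc)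
  show ?thesis
    using face_centered_face[OF fc f(1) m face_center_orthogonal[OF f(1,2) ne]]
      dist_face_center[OF f(1,3)] by simp
qed

text \<open>Let \<open>p\<close> be the point of \<open>P\<close> nearest to \<open>c\<close>, in the relative interior of a face \<open>g\<close>. Then \<open>p\<close> is the foot of the
perpendicular from \<open>c\<close> to \<open>g\<close>. If \<open>g\<close> were a proper face, \<open>p\<close> would be its center, and the centers of all other
faces of that dimension would be just as near to \<open>c\<close>, contradicting uniqueness of the nearest point. So
\<open>g = P\<close>, and \<open>p = c\<close> because \<open>c\<close> lies in the affine hull.\<close>

lemma center_in_rel_interior: "c \<in> rel_interior P"
proof -
  have "P \<noteq> {}" using center_in_hull by auto
  define p where "p = closest_point P c"
  have p: "p \<in> P" "\<forall>z\<in>P. dist c p \<le> dist c z"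
    using closest_point_exists[OF closed \<open>P \<noteq> {}\<close>, of c] by (auto simp: p_def)
  obtain g where g: "g face_of P" "p \<in> rel_interior g"
    using mem_rel_interior_of_face[OF polytope p(1)] by blast
  have pg: "p \<in> g" using g rel_interior_subset by auto
  have pA: "p \<in> affine hull g" using pg by (simp add: hull_inc)
  have gP: "g \<subseteq> P" using g face_of_imp_subset by blast
  have orth: "(c - p) \<bullet> (x - p) = 0" if x: "x \<in> affine hull g" for x
  proof -
    obtain e where e: "e > 0" "cball p e \<inter> affine hull g \<subseteq> g"
      using g(2) by (auto simp: mem_rel_interior_cball)
    \<comment> \<open>A step \<open>s\<close> short enough that \<open>p\<close> can be moved within \<open>P\<close> both towards and away from \<open>x\<close>.\<close>
    define s where "s = e / (norm (x - p) + 1)"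
    have s: "s > 0" using e by (simp add: s_def add_nonneg_pos)
    have sn: "s * norm (x - p) \<le> e"
      using e by (simp add: s_def divide_simps add_nonneg_pos mult_left_mono)
    have step: "p + u *\<^sub>R (x - p) \<in> P" if "\<bar>u\<bar> = s" for u
    proof -
      have "(1 - u) *\<^sub>R p + u *\<^sub>R x \<in> affine hull g"
        using x pA by (intro mem_affine) auto
      then have "p + u *\<^sub>R (x - p) \<in> affine hull g" by (simp add: algebra_simps)
      moreover have "dist p (p + u *\<^sub>R (x - p)) \<le> e"
        using sn that by (simp add: dist_norm)
      ultimately show ?thesis using e gP by (auto simp: mem_cball)
    qed
    have "(c - p) \<bullet> (p + s *\<^sub>R (x - p) - p) \<le> 0"
      by (rule any_closest_point_dot[OF convex closed p(1) _ p(2)]) (use step s in auto)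
    moreover have "(c - p) \<bullet> (p + (- s) *\<^sub>R (x - p) - p) \<le> 0"
      by (rule any_closest_point_dot[OF convex closed p(1) _ p(2)]) (use step[of "-s"] s in auto)
    ultimately have "s * ((c - p) \<bullet> (x - p)) = 0" by simp
    then show ?thesis using s by simp
  qed
  have "g = P"
  proof (rule ccontr)
    assume neq: "g \<noteq> P"
    have "aff_dim g \<ge> 0" using pg aff_dim_geq[of g] aff_dim_empty[of g] by force
    then obtain k where k: "aff_dim g = int k" using nonneg_int_cases by metis
    have gp: "face_center g = p" by (rule face_center_eq_projection[OF g(1) neq pA orth])
    \<comment> \<open>A face of the same dimension as \<open>g\<close> through a vertex outside \<open>g\<close> is different from \<open>g\<close>.\<close>
    obtain v where v: "v extreme_point_of P" "v \<notin> g"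
      using proper_face_misses_extreme_point[OF polytope g(1) neq] by blast
    have "int k \<le> aff_dim P" using face_of_aff_dim_lt[OF convex g(1) neq] k by simp
    then obtain f where f: "f face_of P" "v \<in> f" "aff_dim f = int k"
      using face_of_each_dimension_at_vertex[OF polytope v(1)] by blast
    have "face_center f \<in> f" using face_center_in_face f by blast
    then have fP: "face_center f \<in> P" using f face_of_imp_subset by blast
    have "dist c (face_center f) = dist c p"
      using dist_face_center[OF f(1,3)] dist_face_center[OF g(1) k] gp by simp
    then have "face_center f = p"
      using any_closest_point_unique[OF convex closed fP p(1), of c] p(2) by simp
    then have "p \<in> f" using \<open>face_center f \<in> f\<close> by simp
    then have "g \<subseteq> f" using subset_of_face_of[OF f(1) gP] g by blast
    have fc': "convex f" using f face_of_imp_convex by blast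
    have "g face_of f" using face_of_subset[OF g(1) \<open>g \<subseteq> f\<close>] f face_of_imp_subset by blast
    then have "g = f" using face_of_aff_dim_lt[OF fc'] k f(3) by fastforce
    then show False using v f by blast
  qed
  then have "(c - p) \<bullet> (c - p) = 0" using orth center_in_hull by blast
  then have "c = p" by simp
  then show ?thesis using g \<open>g = P\<close> by simp
qed

lemma dist_facet_center: 
  assumes "g facet_of P"
  shows "dist c (face_center g) = inradius" "inradius > 0"
proof -
  have g: "g face_of P" "g \<noteq> {}" "g \<noteq> P" "aff_dim g = aff_dim P - 1"
    using assms by (auto simp: facet_of_def)
  have "aff_dim g \<ge> 0" using g(2) aff_dim_geq[of g] aff_dim_empty[of g] by force
  then have "aff_dim g = int (nat (aff_dim P - 1))" using g by simp
  then show 1: "dist c (face_center g) = inradius"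
    using dist_face_center[OF g(1)] by (simp add: inradius_def)
  have "face_center g \<in> g" using face_center_in_face g by blast
  moreover have "c \<notin> g" using face_of_disjoint_rel_interior[OF g(1,3)] center_in_rel_interior by blast
  ultimately have "c \<noteq> face_center g" by auto
  then show "inradius > 0" using 1 by (metis zero_less_dist_iff)
qed

lemma norm_facet_center: "g facet_of P \<Longrightarrow> (face_center g - c) \<bullet> (face_center g - c) = inradius\<^sup>2"
  using dist_facet_center(1)[of g] 
  by (simp add: dist_norm norm_minus_commute power2_norm_eq_inner[symmetric])

lemma facet_inner:
  assumes "g facet_of P" "x \<in> affine hull g"
  shows "(x - c) \<bullet> (face_center g - c) = inradius\<^sup>2"
proof -
  have g: "g face_of P" "g \<noteq> {}" "g \<noteq> P"
    using assms by (auto simp: facet_of_def)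
  have "(c - face_center g) \<bullet> (x - face_center g) = 0"
    by (rule face_center_orthogonal[OF g(1,3,2) assms(2)])
  then have "(x - c) \<bullet> (face_center g - c) = (face_center g - c) \<bullet> (face_center g - c)"
    by (simp add: inner_diff inner_commute algebra_simps)
  then show ?thesis using norm_facet_center[OF assms(1)] by simp
qed

lemma facet_center_in_polytope: "g facet_of P \<Longrightarrow> face_center g \<in> P"
  using face_center_in_face[of g] face_of_imp_subset[of g P] by (auto simp: facet_of_def)

text \<open>The right-hand side is an affine set containing the facet. It misses \<open>c\<close>, so its dimension is not larger
than that of the facet.\<close>

lemma affine_hull_facet:
  assumes "g facet_of P"
  shows "affine hull g = {x \<in> affine hull P. (x - c) \<bullet> (face_center g - c) = inradius\<^sup>2}"
proof -
  have g: "g \<subseteq> P" "g \<noteq> {}" "aff_dim g = aff_dim P - 1"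
    using assms by (auto simp: facet_of_def face_of_imp_subset)
  let ?u = "face_center g - c"
  let ?H = "{x \<in> affine hull P. (x - c) \<bullet> ?u = inradius\<^sup>2}"
  have H: "?H = affine hull P \<inter> {x. ?u \<bullet> x = inradius\<^sup>2 + ?u \<bullet> c}"
    by (auto simp: inner_diff inner_commute algebra_simps)
  have aff: "affine ?H" unfolding H by (simp add: affine_Int affine_hyperplane)
  have sub: "affine hull g \<subseteq> ?H"
    using facet_inner[OF assms] hull_mono[OF g(1)] by auto
  have "c \<notin> ?H" using dist_facet_center(2)[OF assms] by simp
  then have "?H \<subset> affine hull P" using center_in_hull by blast
  then have "aff_dim ?H < aff_dim P"
    using aff_dim_psubset[of ?H "affine hull P"] aff 
    by (metis (no_types, lifting) aff_dim_affine_hull affine_affine_hull hull_same)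
  then have "aff_dim ?H \<le> aff_dim g" using g by simp
  moreover have "aff_dim g \<le> aff_dim ?H" using aff_dim_subset[OF sub] by simp
  ultimately show ?thesis
    using affine_dim_equal[OF affine_affine_hull aff _ sub] g(2) by simp
qed

lemma facet_center_inj:
  assumes "g facet_of P" "h facet_of P" "face_center g = face_center h"
  shows "g = h"
proof -
  have "affine hull g = affine hull h" using affine_hull_facet assms by simp
  then show ?thesis
    using face_of_imp_eq_affine_Int[OF convex facet_of_imp_face_of[OF assms(1)]]
      face_of_imp_eq_affine_Int[OF convex facet_of_imp_face_of[OF assms(2)]] by simp
qed

end

section \<open>Neighbouring facets\<close>

lemma other_facet_through_subface:
  fixes P :: "'a::euclidean_space set"
  assumes "polytope P" "g facet_of P" "r face_of P" "r \<noteq> g" "r \<subseteq> g"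
  obtains h where "h facet_of P" "h \<noteq> g" "r \<subseteq> h"
proof (cases "r = {}")
  case True
  have g: "g face_of P" "g \<noteq> P" "g \<noteq> {}" "g \<subseteq> P" 
    using assms(2) by (auto simp: facet_of_def face_of_imp_subset)
  obtain v where v: "v extreme_point_of P" "v \<notin> g"
    using proper_face_misses_extreme_point[OF assms(1) g(1,2)] by blast
  then have "{v} face_of P" "{v} \<noteq> P" using g by (auto simp: face_of_singleton)
  then obtain h where "h facet_of P" "{v} \<subseteq> h"
    using face_of_polyhedron_subset_facet[of P "{v}"] polytope_imp_polyhedron[OF assms(1)] by blast
  then show ?thesis using that[of h] v True by blast
next
  case False
  have "g \<subseteq> P" using assms(2) by (rule facet_of_imp_subset)
  then have "r \<noteq> P" using assms by auto
  then have eq: "r = \<Inter>{h. h facet_of P \<and> r \<subseteq> h}"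
    using face_of_polyhedron[of P r] polytope_imp_polyhedron[OF assms(1)] False assms by blast
  have "\<exists>h. h facet_of P \<and> h \<noteq> g \<and> r \<subseteq> h"
  proof (rule ccontr)
    assume "\<not> ?thesis"
    then have "{h. h facet_of P \<and> r \<subseteq> h} = {g}" using assms by blast
    then show False using eq assms(4) by simp
  qed
  then show ?thesis using that by blast
qed

lemma polytope_subset_of_facets:
  fixes P :: "'a::euclidean_space set"
  assumes "polytope P" "aff_dim P \<ge> 1" "convex S" "\<And>h. h facet_of P \<Longrightarrow> h \<subseteq> S"
  shows "P \<subseteq> S"
proof -
  have "v \<in> S" if v: "v extreme_point_of P" for v
  proof -
    have "{v} face_of P" "{v} \<noteq> P" using v assms(2) by (auto simp: face_of_singleton)
    then obtain h where "h facet_of P" "{v} \<subseteq> h"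
      using face_of_polyhedron_subset_facet[of P "{v}"] polytope_imp_polyhedron[OF assms(1)] by blast
    then show ?thesis using assms(4) by blast
  qed
  then have "convex hull {v. v extreme_point_of P} \<subseteq> S"
    using assms(3) by (intro hull_minimal) auto
  then show ?thesis
    using Krein_Milman_Minkowski[of P] assms(1) polytope_imp_compact polytope_imp_convex by auto
qed

text \<open>The reflection in the hyperplane perpendicular to \<open>a\<close>. For \<open>a = 0\<close> division by zero makes it the identity, so
it is orthogonal for every \<open>a\<close>.\<close>

definition reflect :: "'a::real_inner \<Rightarrow> 'a \<Rightarrow> 'a" where
  "reflect a x = x - (2 * (x \<bullet> a) / (a \<bullet> a)) *\<^sub>R a"

lemma orthogonal_transformation_reflect: "orthogonal_transformation (reflect a)"
proof (cases "a = 0")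
  case True
  then have "reflect a = (\<lambda>x. x)" by (auto simp: reflect_def)
  then show ?thesis by (simp add: orthogonal_transformation_def linear_iff)
next
  case False
  have "linear (reflect a)"
    by (rule linearI) (auto simp: reflect_def algebra_simps add_divide_distrib inner_add_left)
  moreover have "reflect a x \<bullet> reflect a y = x \<bullet> y" for x y
    using False by (simp add: reflect_def inner_diff inner_commute field_simps)
  ultimately show ?thesis by (simp add: orthogonal_transformation_def)
qed

lemma linear_reflect: "linear (reflect a)" 
  and inj_reflect: "inj (reflect (a::'a::euclidean_space))"
  and inner_reflect: "reflect a x \<bullet> reflect a y = x \<bullet> y"
  using orthogonal_transformation_reflect[of a] orthogonal_transformation_inj
  by (auto simp: orthogonal_transformation_def)

definition reflect_at :: "'a::real_inner \<Rightarrow> 'a \<Rightarrow> 'a \<Rightarrow> 'a" where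
  "reflect_at c a x = c + reflect a (x - c)"

text \<open>The form to which the lemmas on images under affine isometries apply.\<close>

lemma reflect_at_altdef:
  fixes c :: "'a::euclidean_space"
  shows "reflect_at c a = (\<lambda>x. (c - reflect a c) + reflect a x)"
  by (simp add: fun_eq_iff reflect_at_def linear_diff[OF linear_reflect])

lemma reflect_at_fixes_iff: "reflect_at c a x = x \<longleftrightarrow> (x - c) \<bullet> a = 0"
  by (cases "a = 0") (auto simp: reflect_at_def reflect_def algebra_simps)

context face_centered_polytope
begin

text \<open>The differences between the centers of facets through the ridge \<open>r\<close> are perpendicular to all vectors from \<open>c\<close> to
\<open>r\<close>. These span a hyperplane of the direction space, so the centers lie on a line. The line meets
the sphere of facet centers in at most two points, one of which is the center of \<open>g\<close>.\<close>

lemma adjacent_facet_center_unique: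
  assumes P': "face_centered_polytope R c P'" "affine hull P' = affine hull P"
    and g: "g facet_of P" "g facet_of P'"
    and h: "h facet_of P" "h \<noteq> g" and h': "h' facet_of P'" "h' \<noteq> g"
    and r: "r \<subseteq> g" "r \<subseteq> h" "r \<subseteq> h'" "aff_dim r = aff_dim P - 2"
  shows "face_center h = face_center h'"
proof -
  interpret P': face_centered_polytope R c P' by fact
  have inr: "P'.inradius = inradius"
    using aff_dim_affine_hull2[OF P'(2)] by (simp add: inradius_def P'.inradius_def)
  let ?\<rho> = "inradius\<^sup>2"
  define u where "u = face_center g - c"
  define a where "a = face_center h - face_center g"
  define a' where "a' = face_center h' - face_center g"
  let ?D = "span ((\<lambda>x. x - c) ` P)" and ?V = "span ((\<lambda>x. x - c) ` r)"
  have gP: "g \<subseteq> P" using g(1) by (rule facet_of_imp_subset)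
  have dimD: "int (dim ?D) = aff_dim P"
    using aff_dim_eq_dim_subtract[OF center_in_hull] by (simp add: dim_span)
  have "c \<notin> affine hull r"
  proof
    assume "c \<in> affine hull r"
    then have "c \<in> affine hull g" using hull_mono[OF r(1)] by blast
    then show False using facet_inner[OF g(1), of c] dist_facet_center(2)[OF g(1)] by simp
  qed
  then have "aff_dim (insert c r) = aff_dim P - 1" using r(4) by (simp add: aff_dim_insert)
  moreover have "aff_dim (insert c r) = int (dim ((\<lambda>x. x - c) ` (insert c r)))"
    by (rule aff_dim_eq_dim_subtract) (simp add: hull_inc)
  moreover have "dim ((\<lambda>x. x - c) ` (insert c r)) = dim ?V" 
    using span_insert_0[of "(\<lambda>x. x - c) ` r"] by (metis diff_self dim_span image_insert)
  ultimately have dimV: "int (dim ?V) = aff_dim P - 1" by simp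
  define W where "W = {y \<in> ?D. \<forall>x\<in>?V. orthogonal x y}"
  have "dim W + dim ?V = dim ?D"
    unfolding W_def
    by (rule dim_subspace_orthogonal_to_vectors) (use r gP in \<open>auto intro!: span_mono\<close>)
  then have dimW: "dim W = 1" using dimD dimV by simp
  have uu: "u \<bullet> u = ?\<rho>" using norm_facet_center[OF g(1)] by (simp add: u_def)
  have in_g: "(x - c) \<bullet> (face_center g - c) = ?\<rho>" if "x \<in> r" for x
    using facet_inner[OF g(1), of x] that r by (auto simp: hull_inc)
  have in_h: "(x - c) \<bullet> (face_center h - c) = ?\<rho>" if "x \<in> r" for x
    using facet_inner[OF h(1), of x] that r by (auto simp: hull_inc)
  have in_h': "(x - c) \<bullet> (face_center h' - c) = ?\<rho>" if "x \<in> r" for x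
    using P'.facet_inner[OF h'(1), of x] that r inr by (auto simp: hull_inc)
  have a_perp: "a \<bullet> (x - c) = 0" if "x \<in> r" for x
    using in_g[OF that] in_h[OF that] by (simp add: a_def inner_diff inner_commute)
  have a'_perp: "a' \<bullet> (x - c) = 0" if "x \<in> r" for x
    using in_g[OF that] in_h'[OF that] by (simp add: a'_def inner_diff inner_commute)
  have mem_D: "y - face_center g \<in> ?D" if "y \<in> affine hull P" for y
  proof -
    have 1: "x - c \<in> ?D" if x: "x \<in> affine hull P" for x
    proof -
      have "x \<in> affine hull (insert c P)" using x hull_mono[of P "insert c P"] by blast
      then show ?thesis
        unfolding affine_hull_insert_span_gen by (auto cong: image_cong_simp)
    qed
    have "(y - c) - (face_center g - c) \<in> ?D"
      using 1[OF that] 1[of "face_center g"] facet_center_in_polytope[OF g(1)] span_diff hull_inc 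
      by metis
    then show ?thesis by simp
  qed
  have aW: "a \<in> W"
  proof -
    have "a \<in> ?D" unfolding a_def
      using facet_center_in_polytope[OF h(1)] by (intro mem_D) (simp add: hull_inc)
    moreover have "orthogonal x a" if "x \<in> ?V" for x
    proof -
      have "orthogonal a x"
        by (rule orthogonal_to_span[OF that]) (use a_perp in \<open>auto simp: orthogonal_def\<close>)
      then show ?thesis by (simp add: orthogonal_commute)
    qed
    ultimately show ?thesis by (simp add: W_def)
  qed
  have aW': "a' \<in> W"
  proof -
    have "face_center h' \<in> affine hull P'"
      using P'.facet_center_in_polytope[OF h'(1)] by (simp add: hull_inc)
    then have "a' \<in> ?D" unfolding a'_def
      using P'(2) by (intro mem_D) simp
    moreover have "orthogonal x a'" if "x \<in> ?V" for x
    proof -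
      have "orthogonal a' x"
        by (rule orthogonal_to_span[OF that]) (use a'_perp in \<open>auto simp: orthogonal_def\<close>)
      then show ?thesis by (simp add: orthogonal_commute)
    qed
    ultimately show ?thesis by (simp add: W_def)
  qed
  have a0: "a \<noteq> 0" using facet_center_inj[OF h(1) g(1)] h(2) by (auto simp: a_def)
  have a0': "a' \<noteq> 0" using P'.facet_center_inj[OF h'(1) g(2)] h'(2) by (auto simp: a'_def)
  have "W \<subseteq> span {a}"
    using card_ge_dim_independent[of "{a}" W] aW a0 dimW by simp
  then obtain t where t: "a' = t *\<^sub>R a" using aW' by (auto simp: span_singleton)
  have t0: "t \<noteq> 0" using a0' t by auto
  \<comment> \<open>The points \<open>u\<close>, \<open>u + a\<close> and \<open>u + t a\<close> have equal norms, which leaves only \<open>t = 0\<close> and \<open>t = 1\<close>.\<close>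
  have eq1: "2 * (u \<bullet> a) + a \<bullet> a = 0"
  proof -
    have "(u + a) \<bullet> (u + a) = ?\<rho>" using norm_facet_center[OF h(1)] by (simp add: u_def a_def)
    then show ?thesis using uu by (simp add: inner_add inner_commute)
  qed
  have eq2: "t * (2 * (u \<bullet> a) + t * (a \<bullet> a)) = 0"
  proof -
    have "(u + a') \<bullet> (u + a') = ?\<rho>" 
      using P'.norm_facet_center[OF h'(1)] inr by (simp add: u_def a'_def)
    then show ?thesis using uu by (simp add: t inner_add inner_commute algebra_simps)
  qed
  have "2 * (u \<bullet> a) + t * (a \<bullet> a) = 0" using eq2 t0 by simp
  then have "(t - 1) * (a \<bullet> a) = 0" using eq1 unfolding left_diff_distrib by linarith
  then have "t = 1" using a0 by simp
  then show ?thesis using t by (simp add: a_def a'_def)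
qed

text \<open>The inner product of \<open>v = w - c\<close> with the facet centers relative to \<open>c\<close> does not change between adjacent facets, so by
connectedness it has the same sign for all of them. If \<open>v \<noteq> 0\<close>, the ray from \<open>c\<close> along \<open>v\<close> leaves \<open>P\<close> through a facet where the product is positive, the opposite ray through one where
it is negative.\<close>

lemma fixed_by_facet_symmetries_imp_center:
  assumes w: "w \<in> affine hull P"
    and fixed: "\<And>g h. \<lbrakk>g facet_of P; h facet_of P; aff_dim (g \<inter> h) = aff_dim P - 2\<rbrakk>
                  \<Longrightarrow> (w - c) \<bullet> (face_center g - face_center h) = 0"
  shows "w = c"
proof (rule ccontr)
  assume "w \<noteq> c"
  define v where "v = w - c"
  have v0: "v \<noteq> 0" using \<open>w \<noteq> c\<close> by (simp add: v_def)
  obtain s f where f: "0 < s" "f facet_of P" "c + s *\<^sub>R v \<in> f"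
    using ray_meets_facet[OF polytope center_in_rel_interior _ v0] w by (auto simp: v_def)
  have "2 *\<^sub>R c + (-1) *\<^sub>R w \<in> affine hull P"
    using w center_in_hull by (intro mem_affine) auto
  then have "c + (- v) \<in> affine hull P" by (simp add: v_def scaleR_2 algebra_simps)
  then obtain t g where g: "0 < t" "g facet_of P" "c + t *\<^sub>R (- v) \<in> g"
    using ray_meets_facet[OF polytope center_in_rel_interior, of "- v"] v0 by auto
  have \<rho>: "inradius\<^sup>2 > 0" using dist_facet_center(2)[OF f(2)] by simp
  have "s * (v \<bullet> (face_center f - c)) = inradius\<^sup>2"
    using facet_inner[OF f(2) hull_inc[OF f(3)]] by simp
  then have pos: "v \<bullet> (face_center f - c) > 0" using f(1) \<rho> by (metis zero_less_mult_pos)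
  have "- (t * (v \<bullet> (face_center g - c))) = inradius\<^sup>2"
    using facet_inner[OF g(2) hull_inc[OF g(3)]] by simp
  then have "t * (- (v \<bullet> (face_center g - c))) > 0" using \<rho> by simp
  then have neg: "\<not> v \<bullet> (face_center g - c) > 0"
    using g(1) by (metis less_asym neg_0_less_iff_less zero_less_mult_pos)
  have "f \<noteq> {}" using f by auto
  then have "aff_dim P \<ge> 1" 
    using f(2) aff_dim_geq[of f] aff_dim_empty[of f] by (simp add: facet_of_def)
  then obtain f' g' where "f' facet_of P" "g' facet_of P" "v \<bullet> (face_center f' - c) > 0"
      "\<not> v \<bullet> (face_center g' - c) > 0" "aff_dim (f' \<inter> g') = aff_dim P - 2"
    using polytope_facets_ridge_connected[OF polytope _ f(2) _ g(2),
      where \<Phi> = "\<lambda>f. v \<bullet> (face_center f - c) > 0"] pos neg by metis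
  moreover from this have "v \<bullet> (face_center f' - face_center g') = 0"
    using fixed by (simp add: v_def)
  ultimately show False by (simp add: inner_diff_right)
qed

end

section \<open>Rigidity and symmetry\<close>

text \<open>The second induction hypothesis is the rigidity of smaller polytopes. The shared face is not called a facet
because for a single point it is empty: this is the case that starts the induction and occurs for the vertices at the
ends of a segment, whose common ridge is empty.\<close>

locale rigid_face_centered_polytope = face_centered_polytope +
  assumes lower_unique:
    "\<And>R' c' (Q :: 'a set) Q' f.
       \<lbrakk>face_centered R' c' Q; face_centered R' c' Q'; affine hull Q = affine hull Q';
        f face_of Q; f face_of Q'; aff_dim f = aff_dim Q - 1; aff_dim Q < aff_dim P\<rbrakk> \<Longrightarrow> Q = Q'"
begin

lemma facet_face_centered:
  assumes "g facet_of P"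
  shows "face_centered (\<lambda>j. sqrt ((R j)\<^sup>2 - inradius\<^sup>2)) (face_center g) g"
proof -
  have g: "g face_of P" "g \<noteq> {}" "g \<noteq> P" "aff_dim g = aff_dim P - 1"
    using assms by (auto simp: facet_of_def)
  have "aff_dim g \<ge> 0" using g(2) aff_dim_geq[of g] aff_dim_empty[of g] by force
  then have "aff_dim g = int (nat (aff_dim P - 1))" using g by simp
  then show ?thesis using proper_face_centered[OF g(1,3)] by (simp add: inradius_def)
qed

text \<open>Otherwise some facet \<open>g\<close> common to \<open>P\<close> and \<open>P'\<close> has, across a ridge, a neighbour \<open>h\<close> in \<open>P\<close> that is not a facet of
\<open>P'\<close>. The facet \<open>h'\<close> of \<open>P'\<close> across the same ridge has the same center as \<open>h\<close>, hence the same hyperplane and radii,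
and shares the ridge with it; by the rigidity of facets \<open>h = h'\<close>.\<close>

lemma subset_of_shared_facet:
  assumes P': "face_centered R c P'" "affine hull P' = affine hull P"
    and f: "f facet_of P" "f facet_of P'"
  shows "P \<subseteq> P'"
proof (rule ccontr)
  assume nsub: "\<not> P \<subseteq> P'"
  have dim: "aff_dim P' = aff_dim P" using aff_dim_affine_hull2[OF P'(2)] .
  interpret P': rigid_face_centered_polytope R c P'
    using P'(1) lower lower_unique dim by unfold_locales auto
  have inr: "P'.inradius = inradius" by (simp add: inradius_def P'.inradius_def dim)
  have "f \<noteq> {}" using f by (simp add: facet_of_def)
  then have dim1: "aff_dim P \<ge> 1" 
    using f(1) aff_dim_geq[of f] aff_dim_empty[of f] by (simp add: facet_of_def)
  have "\<not> (\<forall>h. h facet_of P \<longrightarrow> h facet_of P')"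
  proof
    assume all: "\<forall>h. h facet_of P \<longrightarrow> h facet_of P'"
    have "P \<subseteq> P'"
      by (rule polytope_subset_of_facets[OF polytope dim1 P'.convex])
        (use all facet_of_imp_subset in blast)
    then show False using nsub by contradiction
  qed
  then obtain h0 where h0: "h0 facet_of P" "\<not> h0 facet_of P'" by blast
  obtain g h where gh: "g facet_of P" "h facet_of P" "g facet_of P'" "\<not> h facet_of P'"
      "aff_dim (g \<inter> h) = aff_dim P - 2"
    using polytope_facets_ridge_connected[OF polytope dim1 f(1) _ h0(1),
        where \<Phi> = "\<lambda>g. g facet_of P'"] f(2) h0(2) by blast
  define r where "r = g \<inter> h"
  have r: "r \<subseteq> g" "r \<subseteq> h" "aff_dim r = aff_dim P - 2" using gh by (auto simp: r_def)
  have "r face_of P" using gh by (simp add: r_def face_of_Int facet_of_imp_face_of)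
  then have "r face_of g" "r face_of h"
    using r gh facet_of_imp_subset by (blast intro: face_of_subset)+
  then have rP': "r face_of P'" using face_of_trans gh(3) facet_of_imp_face_of by blast
  have "r \<noteq> g" using r(3) gh(1) by (auto simp: facet_of_def)
  then obtain h' where h': "h' facet_of P'" "h' \<noteq> g" "r \<subseteq> h'"
    using other_facet_through_subface[OF P'.polytope gh(3) rP' _ r(1)] by blast
  have "r face_of h'"
    using rP' h' facet_of_imp_subset by (blast intro: face_of_subset)
  have "h \<noteq> g" using gh by auto
  have center: "face_center h = face_center h'"
    using adjacent_facet_center_unique[OF P'.face_centered_polytope_axioms P'(2) gh(1,3,2) \<open>h \<noteq> g\<close>
        h'(1,2) r(1,2) h'(3) r(3)] .
  have "affine hull h = affine hull h'"
    using affine_hull_facet[OF gh(2)] P'.affine_hull_facet[OF h'(1)] P'(2) inr center by simp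
  then have "h = h'"
    using lower_unique[OF facet_face_centered[OF gh(2)] _ _ \<open>r face_of h\<close> \<open>r face_of h'\<close>]
      P'.facet_face_centered[OF h'(1)] center inr r(3) gh(2) by (simp add: facet_of_def)
  then show False using gh(4) h'(1) by simp
qed

lemma eq_of_shared_facet:
  assumes P': "face_centered R c P'" "affine hull P' = affine hull P"
    and f: "f facet_of P" "f facet_of P'"
  shows "P = P'"
proof -
  have dim: "aff_dim P' = aff_dim P" using aff_dim_affine_hull2[OF P'(2)] .
  interpret P': rigid_face_centered_polytope R c P'
    using P'(1) lower lower_unique dim by unfold_locales auto
  show ?thesis
    using subset_of_shared_facet[OF P' f] P'.subset_of_shared_facet[OF fc P'(2)[symmetric] f(2,1)]
    by blast
qed

text \<open>The reflection exchanges the two facet centers, because they are at the same distance from \<open>c\<close>, and it fixes the ridge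
\<open>g \<inter> h\<close> pointwise, because a point of both facets has the same inner product with both centers.
It carries the hyperplane of \<open>g\<close> to that of \<open>h\<close>. So the image of \<open>g\<close> and \<open>h\<close> share center, radii, hull and a ridge,
and they coincide; then the image of \<open>P\<close> and \<open>P\<close> share the facet \<open>h\<close>, and they coincide too.\<close>

lemma reflection_symmetry:
  assumes g: "g facet_of P" and h: "h facet_of P" and adj: "aff_dim (g \<inter> h) = aff_dim P - 2"
  shows "reflect_at c (face_center g - face_center h) ` P = P"
proof -
  define a where "a = face_center g - face_center h"
  define T where "T = reflect_at c a"
  have T: "T = (\<lambda>x. (c - reflect a c) + reflect a x)"
    by (simp add: T_def reflect_at_altdef)
  note lin = linear_reflect[of a] inj_reflect[of a]
  have Tc: "T c = c" by (simp add: T_def reflect_at_fixes_iff)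
  have Tdiff: "T x - c = reflect a (x - c)" for x by (simp add: T_def reflect_at_def)
  have "g \<noteq> h" using adj g by (auto simp: facet_of_def)
  then have a0: "a \<noteq> 0" using facet_center_inj[OF g h] by (auto simp: a_def)
  have Tg: "T (face_center g) = face_center h"
  proof -
    let ?u = "face_center g - c" and ?v = "face_center h - c"
    have "a = ?u - ?v" by (simp add: a_def)
    then have "2 * (?u \<bullet> a) = a \<bullet> a"
      using norm_facet_center[OF g] norm_facet_center[OF h]
      by (simp add: inner_diff inner_commute)
    then have "T (face_center g) = face_center g - a"
      using a0 by (simp add: T_def reflect_at_def reflect_def)
    then show ?thesis by (simp add: a_def)
  qed
  have T_hull: "T x \<in> affine hull P" if "x \<in> affine hull P" for x
  proof -
    define s where "s = 2 * ((x - c) \<bullet> a) / (a \<bullet> a)"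
    have "x + (- s) *\<^sub>R (face_center g - face_center h) \<in> affine hull P"
      using that facet_center_in_polytope[OF g] facet_center_in_polytope[OF h]
      using mem_affine_3_minus[of "affine hull P" x "face_center g" "face_center h" "- s"]
      by (simp add: hull_inc)
    then show ?thesis by (simp add: T_def reflect_at_def reflect_def s_def a_def)
  qed
  have hull_eq: "affine hull (T ` S) = affine hull S'"
    if "T ` (affine hull S) \<subseteq> affine hull S'" "S \<noteq> {}" "aff_dim S = aff_dim S'" for S S'
  proof (rule affine_dim_equal)
    show "affine hull (T ` S) \<subseteq> affine hull S'"
      using that(1) affine_hull_affine_image[OF lin(1)] by (simp add: T)
    show "aff_dim (affine hull (T ` S)) = aff_dim (affine hull S')"
      using that(3) aff_dim_affine_image[OF lin] by (simp add: T)
  qed (use that in auto)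
  have dimT: "aff_dim (T ` S) = aff_dim S" for S
    using aff_dim_affine_image[OF lin] by (simp add: T)
  have fc_T: "face_centered R' (T c') (T ` Q)" if "face_centered R' c' Q" for R' c' Q
    using face_centered_isometric_image[OF that orthogonal_transformation_reflect] by (simp add: T)
  have face_T: "T ` f face_of T ` Q" if "f face_of Q" for f Q
    using that face_of_affine_image[OF lin] by (simp add: T)
  have gne: "g \<noteq> {}" "h \<noteq> {}" and Pne: "P \<noteq> {}" 
    using g h by (auto simp: facet_of_def)
  have hull_g: "affine hull (T ` g) = affine hull h"
  proof (rule hull_eq)
    show "T ` (affine hull g) \<subseteq> affine hull h"
    proof
      fix y assume "y \<in> T ` (affine hull g)"
      then obtain x where x: "x \<in> affine hull g" "y = T x" by blast
      have "y \<in> affine hull P" using x affine_hull_facet[OF g] T_hull by simp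
      moreover have "(y - c) \<bullet> (face_center h - c) = inradius\<^sup>2"
        using facet_inner[OF g x(1)] by (simp only: x(2) Tg[symmetric] Tdiff inner_reflect)
      ultimately show "y \<in> affine hull h" using affine_hull_facet[OF h] by simp
    qed
  qed (use gne g h in \<open>auto simp: facet_of_def\<close>)
  have hull_P: "affine hull (T ` P) = affine hull P"
    by (rule hull_eq) (use T_hull Pne in auto)
  have fixed: "T ` (g \<inter> h) = g \<inter> h"
  proof -
    have "T x = x" if x: "x \<in> g \<inter> h" for x
    proof -
      have "(x - c) \<bullet> (face_center g - c) = (x - c) \<bullet> (face_center h - c)"
        using x facet_inner[OF g, of x] facet_inner[OF h, of x] by (simp add: hull_inc)
      then show ?thesis
        by (simp add: T_def reflect_at_fixes_iff a_def inner_diff_right)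
    qed
    then show ?thesis by simp
  qed
  have "g \<inter> h face_of P" using g h by (simp add: face_of_Int facet_of_imp_face_of)
  then have r: "g \<inter> h face_of g" "g \<inter> h face_of h"
    using g h facet_of_imp_subset by (blast intro: face_of_subset)+
  have rT: "g \<inter> h face_of T ` g" using face_T[OF r(1)] fixed by simp
  have fcT: "face_centered (\<lambda>j. sqrt ((R j)\<^sup>2 - inradius\<^sup>2)) (face_center h) (T ` g)"
    using fc_T[OF facet_face_centered[OF g]] Tg by simp
  have "T ` g = h"
    using lower_unique[OF fcT facet_face_centered[OF h] hull_g rT r(2)] adj g dimT[of g]
    by (simp add: facet_of_def)
  then have "h facet_of T ` P"
    using face_T[OF facet_of_imp_face_of[OF g]] gne h dimT by (simp add: facet_of_def)
  moreover have "face_centered R c (T ` P)" using fc_T[OF fc] Tc by simp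
  ultimately have "P = T ` P"
    using eq_of_shared_facet[OF _ hull_P h] by blast
  then show ?thesis by (simp add: T_def a_def)
qed

lemma symmetric_point_eq_center:
  assumes "w \<in> affine hull P"
    and fixed: "\<And>a. reflect_at c a ` P = P \<Longrightarrow> reflect_at c a w = w"
  shows "w = c"
  using assms(1)
proof (rule fixed_by_facet_symmetries_imp_center)
  fix g h
  assume "g facet_of P" "h facet_of P" "aff_dim (g \<inter> h) = aff_dim P - 2"
  then show "(w - c) \<bullet> (face_center g - face_center h) = 0"
    using fixed reflection_symmetry reflect_at_fixes_iff by blast
qed

lemma face_center_reflect_at:
  assumes "f face_of P" "f \<noteq> {}"
  shows "face_center (reflect_at c a ` f) = reflect_at c a (face_center f)"
  using face_center_affine_image[OF _ assms(2) linear_reflect inj_reflect]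
    face_of_polytope_polytope[OF polytope assms(1)]
  by (simp add: reflect_at_altdef)

lemma face_center_polytope_eq: "face_center P = c"
proof (rule symmetric_point_eq_center)
  have ne: "P face_of P" "P \<noteq> {}" using center_in_hull convex by (auto simp: face_of_refl)
  then show "face_center P \<in> affine hull P" using face_center_in_face by (blast intro: hull_inc)
  show "reflect_at c a (face_center P) = face_center P" if "reflect_at c a ` P = P" for a
    using face_center_reflect_at[OF ne, of a] that by simp
qed

text \<open>A symmetry permutes the facets and hence fixes the sum. The sum is taken relative to \<open>c\<close>, so that adding
it to \<open>c\<close> gives a point of the affine hull of \<open>P\<close>, as the symmetry argument requires.\<close>

lemma sum_facet_centers: "(\<Sum>f | f facet_of P. face_center f - c) = 0"
proof -
  let ?X = "{f. f facet_of P}"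
  have fin: "finite ?X" using finite_polytope_facets[OF polytope] .
  have mem: "c + (\<Sum>f\<in>Y. face_center f - c) \<in> affine hull P" if "finite Y" "Y \<subseteq> ?X" for Y
    using that
  proof (induction Y rule: finite_induct)
    case empty
    then show ?case using center_in_hull by simp
  next
    case (insert f Y)
    have "(c + (\<Sum>f\<in>Y. face_center f - c)) + 1 *\<^sub>R (face_center f - c) \<in> affine hull P"
      using insert facet_center_in_polytope[of f] center_in_hull
      by (intro mem_affine_3_minus) (auto simp: hull_inc)
    then show ?case using insert by (simp add: algebra_simps)
  qed
  have "c + (\<Sum>f\<in>?X. face_center f - c) = c"
  proof (rule symmetric_point_eq_center)
    show "c + (\<Sum>f\<in>?X. face_center f - c) \<in> affine hull P" using mem[OF fin] by simp
    fix a assume inv: "reflect_at c a ` P = P"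
    let ?T = "reflect_at c a"
    have T: "?T = (\<lambda>x. (c - reflect a c) + reflect a x)" by (rule reflect_at_altdef)
    have injT: "inj ?T" using inj_reflect[of a] unfolding T inj_def by simp
    have facet: "?T ` f \<in> ?X" if "f \<in> ?X" for f
    proof -
      have "f face_of P" using that by (simp add: facet_of_imp_face_of)
      then have "?T ` f face_of ?T ` P"
        using face_of_affine_image[OF linear_reflect[of a] inj_reflect[of a]] by (simp add: T)
      moreover have "aff_dim (?T ` f) = aff_dim f"
        using aff_dim_affine_image[OF linear_reflect[of a] inj_reflect[of a]] by (simp add: T)
      ultimately show ?thesis using that inv by (simp add: facet_of_def)
    qed
    have inj_im: "inj_on ((`) ?T) ?X" using injT by (simp add: inj_on_def inj_image_eq_iff)
    then have perm: "(`) ?T ` ?X = ?X" using facet by (intro endo_inj_surj[OF fin]) auto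
    have "reflect a (\<Sum>f\<in>?X. face_center f - c) = (\<Sum>f\<in>?X. reflect a (face_center f - c))"
      by (rule linear_sum[OF linear_reflect])
    also have "\<dots> = (\<Sum>f\<in>?X. face_center (?T ` f) - c)"
    proof (rule sum.cong)
      fix f assume "f \<in> ?X"
      then have "face_center (?T ` f) = ?T (face_center f)"
        by (intro face_center_reflect_at) (auto simp: facet_of_def)
      then show "reflect a (face_center f - c) = face_center (?T ` f) - c"
        by (simp add: reflect_at_def)
    qed simp
    also have "\<dots> = (\<Sum>f\<in>(`) ?T ` ?X. face_center f - c)"
      by (simp add: sum.reindex[OF inj_im])
    also have "\<dots> = (\<Sum>f\<in>?X. face_center f - c)" by (simp only: perm)
    finally show "?T (c + (\<Sum>f\<in>?X. face_center f - c)) = c + (\<Sum>f\<in>?X. face_center f - c)"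
      by (simp add: reflect_at_def)
  qed
  then show ?thesis by simp
qed

end

section \<open>Induction on the dimension and the sum of squares\<close>

lemma face_centered_rigid:
  fixes P :: "'a::euclidean_space set"
  assumes "face_centered R c P"
  shows "rigid_face_centered_polytope R c P"
  using assms
proof (induction "nat (aff_dim P)" arbitrary: R c P rule: less_induct)
  case less
  have rigid: "rigid_face_centered_polytope R' c' Q"
    if Q: "face_centered R' c' Q" "aff_dim Q < aff_dim P" for R' c' and Q :: "'a set"
  proof (rule less.hyps[OF _ Q(1)])
    have "Q \<noteq> {}" using Q by (auto simp: face_centered_def)
    then have "aff_dim Q \<ge> 0" using aff_dim_geq[of Q] aff_dim_empty[of Q] by force
    then show "nat (aff_dim Q) < nat (aff_dim P)" using Q(2) by simp
  qed
  show ?case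
  proof unfold_locales
    show "face_centered R c P" by fact
    show "face_center Q = c'" if "face_centered R' c' Q" "aff_dim Q < aff_dim P"
      for R' c' and Q :: "'a set"
      using rigid_face_centered_polytope.face_center_polytope_eq[OF rigid[OF that]] .
    show "Q = Q'"
      if Q: "face_centered R' c' Q" "face_centered R' c' Q'" "affine hull Q = affine hull Q'"
        "f face_of Q" "f face_of Q'" "aff_dim f = aff_dim Q - 1" "aff_dim Q < aff_dim P"
      for R' c' and Q Q' f :: "'a set"
    proof (cases "f = {}")
      case True
      then have "aff_dim Q = 0" "aff_dim Q' = 0"
        using Q(6) aff_dim_affine_hull2[OF Q(3)] by (auto simp: aff_dim_empty)
      then obtain x y where "Q = {x}" "Q' = {y}" by (auto simp: aff_dim_eq_0)
      then show ?thesis using Q(3) by simp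
    next
      case False
      then have "f facet_of Q" "f facet_of Q'"
        using Q aff_dim_affine_hull2[OF Q(3)] by (auto simp: facet_of_def)
      then show ?thesis
        using rigid_face_centered_polytope.eq_of_shared_facet[OF rigid[OF Q(1,7)] Q(2) Q(3)[symmetric]]
        by blast
    qed
  qed
qed

theorem corollary3p5:
  fixes Q :: "'a::euclidean_space set" and c :: 'a
    and F N :: nat and \<sigma> :: "nat \<Rightarrow> 'a set" and s :: "nat \<Rightarrow> real"
  assumes "DIM('a) \<ge> 2"
    and "regular_polytope Q"
    and "circumscribed_about_sphere Q c 1"
    and "F = card {f. f facet_of Q}"
    and "N = card (facet_center_segments Q)"
    and "bij_betw \<sigma> {1..N} (facet_center_segments Q)"
    and "\<And>i. i \<in> {1..N} \<Longrightarrow> s i = diameter (\<sigma> i)"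
  shows "(\<Sum>i = 1..N. (s i)\<^sup>2) = (real F)\<^sup>2"
proof -
  have Q: "polytope Q" "aff_dim Q = int DIM('a)"
    using assms(2) by (auto simp: regular_polytope_def full_dim_polytope_def)
  have "is_center Q c" using assms(3) by (simp add: circumscribed_about_sphere_def)
  then have "\<forall>j\<in>{0..int DIM('a)}. \<exists>R. \<forall>f. dim_face_of f j Q \<longrightarrow> dist c (face_center f) = R"
    by (simp add: is_center_def)
  then obtain R where R: "\<And>j f. \<lbrakk>j \<in> {0..int DIM('a)}; dim_face_of f j Q\<rbrakk>
      \<Longrightarrow> dist c (face_center f) = R j" by metis
  have "face_centered (\<lambda>j. R (int j)) c Q"
    unfolding face_centered_def
  proof (intro conjI allI impI)
    show "c \<in> affine hull Q" using Q(2) aff_dim_eq_full[of Q] by simp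
    fix f j assume f: "f face_of Q \<and> aff_dim f = int j"
    have "aff_dim f \<le> int DIM('a)" by (rule aff_dim_le_DIM)
    then show "dist c (face_center f) = R (int j)" 
      using f by (intro R) (auto simp: dim_face_of_def)
  qed (rule Q(1))
  then interpret rigid_face_centered_polytope "\<lambda>j. R (int j)" c Q by (rule face_centered_rigid)
  let ?X = "{f. f facet_of Q}"
  have fin: "finite ?X" using finite_polytope_facets[OF Q(1)] .
  define u where "u f = face_center f - c" for f
  have sum_u: "(\<Sum>f\<in>?X. u f) = 0" using sum_facet_centers by (simp add: u_def)
  have unit: "u f \<bullet> u f = 1" if "f \<in> ?X" for f
  proof -
    have "tangent_to_sphere_at f c 1 (face_center f)"
      using that assms(3) by (simp add: circumscribed_about_sphere_def)
    then have "face_center f \<in> sphere c 1" by (auto simp: tangent_to_sphere_at_def)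
    then show ?thesis
      by (simp add: u_def dist_norm norm_minus_commute power2_norm_eq_inner[symmetric])
  qed
  have inj: "face_center f = face_center g \<longleftrightarrow> f = g" if "f \<in> ?X" "g \<in> ?X" for f g
    using facet_center_inj[of f g] that by auto
  \<comment> \<open>Sums over segments are computed as sums over ordered pairs of distinct facets, each segment arising from exactly two.\<close>
  define E where "E = {(f, g) \<in> ?X \<times> ?X. f \<noteq> g}"
  define seg :: "'a set \<times> 'a set \<Rightarrow> 'a set"
    where "seg = (\<lambda>(f, g). closed_segment (face_center f) (face_center g))"
  have finE: "finite E" using fin by (auto simp: E_def intro: finite_subset[of _ "?X \<times> ?X"])
  have segs: "facet_center_segments Q = seg ` E"
    by (force simp: facet_center_segments_def seg_def E_def)
  have seg_eq: "seg (f', g') = seg (f, g) \<longleftrightarrow> f' = f \<and> g' = g \<or> f' = g \<and> g' = f"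
    if "f \<in> ?X" "g \<in> ?X" "f' \<in> ?X" "g' \<in> ?X" for f g f' g'
    using that by (simp add: seg_def doubleton_eq_iff inj)
  have fiber: "(\<Sum>e\<in>{e \<in> E. seg e = S}. (diameter (seg e))\<^sup>2) = 2 * (diameter S)\<^sup>2"
    if S: "S \<in> seg ` E" for S
  proof -
    obtain f g where fg: "f \<in> ?X" "g \<in> ?X" "f \<noteq> g" "S = seg (f, g)"
      using S by (auto simp: E_def)
    have comm: "seg (g, f) = seg (f, g)" by (simp add: seg_def closed_segment_commute)
    have "{e \<in> E. seg e = S} = {(f, g), (g, f)}"
      unfolding fg(4) using fg(1-3) by (auto simp: E_def seg_eq comm)
    then show ?thesis using fg(3,4) comm by simp
  qed
  have "(\<Sum>i = 1..N. (s i)\<^sup>2) = (\<Sum>i = 1..N. (diameter (\<sigma> i))\<^sup>2)"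
    using assms(7) by simp
  also have "\<dots> = (\<Sum>S\<in>seg ` E. (diameter S)\<^sup>2)"
    using sum.reindex_bij_betw[OF assms(6)] segs by simp
  finally have "2 * (\<Sum>i = 1..N. (s i)\<^sup>2) = (\<Sum>S\<in>seg ` E. 2 * (diameter S)\<^sup>2)"
    by (simp add: sum_distrib_left)
  also have "\<dots> = (\<Sum>S\<in>seg ` E. \<Sum>e\<in>{e \<in> E. seg e = S}. (diameter (seg e))\<^sup>2)"
    using fiber by (intro sum.cong) auto
  also have "\<dots> = (\<Sum>e\<in>E. (diameter (seg e))\<^sup>2)"
    using sum.image_gen[OF finE, of "\<lambda>e. (diameter (seg e))\<^sup>2" seg] by simp
  also have "\<dots> = (\<Sum>(f, g)\<in>E. (norm (u f - u g))\<^sup>2)"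
    by (intro sum.cong) (auto simp: seg_def diameter_closed_segment dist_norm u_def)
  \<comment> \<open>The diagonal contributes zero, so that the double sum splits.\<close>
  also have "\<dots> = (\<Sum>(f, g)\<in>?X \<times> ?X. (norm (u f - u g))\<^sup>2)"
    using fin by (intro sum.mono_neutral_left) (auto simp: E_def)
  also have "\<dots> = (\<Sum>f\<in>?X. \<Sum>g\<in>?X. 2 - 2 * (u f \<bullet> u g))"
    unfolding sum.cartesian_product[symmetric]
    by (intro sum.cong) (auto simp: power2_norm_eq_inner inner_diff inner_commute unit)
  also have "\<dots> = (\<Sum>f\<in>?X. 2 * real F - 2 * (u f \<bullet> (\<Sum>g\<in>?X. u g)))"
    by (simp add: sum_subtractf inner_sum_right sum_distrib_left assms(4))
  also have "\<dots> = 2 * (real F)\<^sup>2" by (simp add: sum_u assms(4) power2_eq_square)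
  finally show ?thesis by simp
qed

end
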